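(* Let $q$ be an odd prime and $d\ge 1$. There is no orthonormal basis for $L^2(\mathbb{F}_q^d)$ of the form $\{\delta_a\tau_\lambda\psi\}_{a\in\mathcal{A},\,\lambda\in\Lambda}$, with $\mathcal{A}\subseteq\mathrm{Aut}(\mathbb{F}_q^d)$ and $\Lambda\subseteq\mathbb{F}_q^d$, where $\hat\psi=1_E$ and $E\subsetneq\mathbb{F}_q^d$.
   Context: $\mathbb{F}_q$ is the field with $q$ elements and $\mathrm{Aut}(\mathbb{F}_q^d)$ is the set of automorphisms (invertible linear maps) of $\mathbb{F}_q^d$. For $m,x\in\mathbb{F}_q^d$, $\chi_m(x)=e^{2\pi i\, m\cdot x/q}$. For $f:\mathbb{F}_q^d\to\mathbb{C}$ the Fourier transform is $\hat f(\xi)=q^{-d}\sum_{m\in\mathbb{F}_q^d} f(m)\overline{\chi_m(\xi)}$. The inner product on the space $L^2(\mathbb{F}_q^d)$ on which the wavelet system lives is $\langle f,g\rangle=q^{-d}\sum_x f(x)\overline{g(x)}$, while on the Fourier side it is $\sum_m f(m)\overline{g(m)}$, so that $f\mapsto\hat f$ is unitary. The dilation and translation operators are $\delta_a\psi(x)=\psi(ax)$ and $\tau_t\psi(x)=\psi(x-t)$, so $\delta_a\tau_t\psi(x)=\psi(ax-t)$. $1_E$ is the indicator function of $E$. The family is indexed by the pairs $(a,\lambda)$. *)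

theory Defs
  imports "HOL-Analysis.Analysis" "Berlekamp_Zassenhaus.Finite_Field"
begin

text \<open>For \<open>'p :: prime_card\<close>, the type \<open>'p mod_ring\<close> is the prime field with
  \<open>q = CARD('p)\<close> elements, so \<open>('p, 'd) fq_vec\<close> is its coordinate space of dimension
  \<open>d = CARD('d) \<ge> 1\<close>.\<close>

type_synonym ('p, 'd) fq_vec = "('p mod_ring, 'd) vec"

definition Aut :: "(('p::prime_card, 'd::finite) fq_vec \<Rightarrow> ('p, 'd) fq_vec) set"
  where "Aut = {a. Vector_Spaces.linear (*s) (*s) a \<and> bij a}"

definition dot :: "('p::prime_card, 'd::finite) fq_vec \<Rightarrow> ('p, 'd) fq_vec \<Rightarrow> 'p mod_ring"
  where "dot m x = (\<Sum>i\<in>UNIV. m $ i * x $ i)"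

text \<open>The residue \<open>m \<cdot> x\<close> enters the exponential through its representative in
  \<open>{0..<q}\<close>; the value does not depend on the choice of representative.\<close>

definition chi :: "('p::prime_card, 'd::finite) fq_vec \<Rightarrow> ('p, 'd) fq_vec \<Rightarrow> complex"
  where "chi m x =
    exp (2 * of_real pi * \<i> * of_int (to_int_mod_ring (dot m x)) / of_nat CARD('p))"

definition fourier ::
    "(('p::prime_card, 'd::finite) fq_vec \<Rightarrow> complex) \<Rightarrow> ('p, 'd) fq_vec \<Rightarrow> complex"
  where "fourier f \<xi> =
    1 / of_nat (CARD('p) ^ CARD('d)) * (\<Sum>m\<in>UNIV. f m * cnj (chi m \<xi>))"

text \<open>This is the normalised inner product on the space side; with the counting inner product on
  the frequency side, \<^const>\<open>fourier\<close> is unitary.\<close>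

definition L2_inner ::
    "(('p::prime_card, 'd::finite) fq_vec \<Rightarrow> complex) \<Rightarrow> (('p, 'd) fq_vec \<Rightarrow> complex) \<Rightarrow> complex"
  where "L2_inner f g =
    1 / of_nat (CARD('p) ^ CARD('d)) * (\<Sum>x\<in>UNIV. f x * cnj (g x))"

text \<open>The basis is a family indexed by \<open>I\<close>, not merely its set of values: distinct indices must
  carry orthogonal vectors.\<close>

definition orthonormal_basis ::
    "'i::finite set \<Rightarrow> ('i \<Rightarrow> ('p::prime_card, 'd::finite) fq_vec \<Rightarrow> complex) \<Rightarrow> bool"
  where "orthonormal_basis I b \<longleftrightarrow>
    (\<forall>i\<in>I. \<forall>j\<in>I. L2_inner (b i) (b j) = (if i = j then 1 else 0)) \<and>
    (\<forall>f. \<exists>c. \<forall>x. f x = (\<Sum>i\<in>I. c i * b i x))"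

definition dilation ::
    "(('p::prime_card, 'd::finite) fq_vec \<Rightarrow> ('p, 'd) fq_vec) \<Rightarrow>
     (('p, 'd) fq_vec \<Rightarrow> complex) \<Rightarrow> ('p, 'd) fq_vec \<Rightarrow> complex"
  where "dilation a \<psi> x = \<psi> (a x)"

definition translation ::
    "('p::prime_card, 'd::finite) fq_vec \<Rightarrow>
     (('p, 'd) fq_vec \<Rightarrow> complex) \<Rightarrow> ('p, 'd) fq_vec \<Rightarrow> complex"
  where "translation t \<psi> x = \<psi> (x - t)"

end

theory Submission
  imports Defs
begin

text \<open>The mean value of a function on \<open>\<F>\<^sub>q\<^sup>d\<close> is its Fourier coefficient at \<open>0\<close>, and it does not
  change under invertible dilations and translations. Hence every member of the system has the same
  mean \<open>\<mu> = 1\<^sub>E(0)\<close>, which is \<open>0\<close> or \<open>1\<close>. Expand the constant function \<open>1\<close> in the assumed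
  orthonormal basis: all its coefficients are the conjugate of \<open>\<mu>\<close>, so taking means of the expansion
  gives \<open>1 = N \<bar>\<mu>\<bar>\<^sup>2\<close>, where \<open>N\<close> is the number of basis vectors. Therefore \<open>\<mu> = 1\<close> and \<open>N = 1\<close>.
  But a single vector, which here must span the constants, cannot span a space that contains
  nonconstant functions.\<close>

lemma L2_inner_sum_left:
  "L2_inner (\<lambda>x. \<Sum>i\<in>I. c i * b i x) g = (\<Sum>i\<in>I. c i * L2_inner (b i) g)"
proof -
  have "(\<Sum>x\<in>UNIV. (\<Sum>i\<in>I. c i * b i x) * cnj (g x))
      = (\<Sum>i\<in>I. \<Sum>x\<in>UNIV. c i * b i x * cnj (g x))"
    by (subst sum.swap) (simp add: sum_distrib_right)
  then show ?thesis
    by (simp add: L2_inner_def sum_distrib_left mult_ac)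
qed

lemma L2_inner_commute: "L2_inner f g = cnj (L2_inner g f)"
  by (simp add: L2_inner_def mult_ac)

lemma orthonormal_basis_coefficient:
  assumes "orthonormal_basis I b" "i \<in> I"
  shows "L2_inner (\<lambda>x. \<Sum>j\<in>I. c j * b j x) (b i) = c i"
proof -
  have "L2_inner (\<lambda>x. \<Sum>j\<in>I. c j * b j x) (b i) = (\<Sum>j\<in>I. c j * L2_inner (b j) (b i))"
    by (rule L2_inner_sum_left)
  also have "\<dots> = (\<Sum>j\<in>I. if j = i then c j else 0)"
    using assms by (intro sum.cong) (auto simp: orthonormal_basis_def)
  also have "\<dots> = c i"
    using assms(2) by simp
  finally show ?thesis .
qed

text \<open>Pairing with the constant function \<open>1\<close> is taking the mean.\<close>

lemma fourier_zero_eq_mean: "fourier f 0 = L2_inner f (\<lambda>_. 1)"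
  by (simp add: fourier_def L2_inner_def chi_def dot_def)

lemma mean_one: "L2_inner (\<lambda>_. 1) (\<lambda>_. 1) = 1"
  by (simp add: L2_inner_def CARD_vec)

text \<open>The affine map \<open>x \<mapsto> a x - t\<close> permutes the points over which the mean is taken.\<close>

lemma mean_dilation_translation:
  assumes "bij a"
  shows "L2_inner (dilation a (translation t \<psi>)) (\<lambda>_. 1) = L2_inner \<psi> (\<lambda>_. 1)"
proof -
  have "bij ((\<lambda>x. x - t) \<circ> a)"
    using assms bij_diff_right by (rule bij_comp)
  then have "(\<Sum>x\<in>UNIV. \<psi> (a x - t)) = (\<Sum>x\<in>UNIV. \<psi> x)"
    using sum.reindex_bij_betw[of "(\<lambda>x. x - t) \<circ> a" UNIV UNIV \<psi>] by simp
  then show ?thesis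
    by (simp add: L2_inner_def dilation_def translation_def)
qed

text \<open>Each coefficient of the constant function \<open>1\<close> is the conjugate of the common mean.\<close>

lemma card_orthonormal_basis_of_equal_means:
  assumes basis: "orthonormal_basis I b"
    and mean: "\<And>i. i \<in> I \<Longrightarrow> L2_inner (b i) (\<lambda>_. 1) = \<mu>"
  shows "of_nat (card I) * (\<mu> * cnj \<mu>) = 1"
proof -
  obtain c where "\<And>x. 1 = (\<Sum>i\<in>I. c i * b i x)"
    using basis unfolding orthonormal_basis_def by meson
  then have one: "(\<lambda>_. 1) = (\<lambda>x. \<Sum>i\<in>I. c i * b i x)"
    by blast
  have c: "c i = cnj \<mu>" if "i \<in> I" for i
    using orthonormal_basis_coefficient[OF basis that, of c] mean[OF that]
      L2_inner_commute[of "\<lambda>_. 1" "b i"]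
    by (simp flip: one)
  have "1 = L2_inner (\<lambda>x. \<Sum>i\<in>I. c i * b i x) (\<lambda>_. 1)"
    by (simp add: mean_one flip: one)
  also have "\<dots> = (\<Sum>i\<in>I. c i * L2_inner (b i) (\<lambda>_. 1))"
    by (rule L2_inner_sum_left)
  also have "\<dots> = (\<Sum>i\<in>I. cnj \<mu> * \<mu>)"
    using c mean by (intro sum.cong) auto
  finally show ?thesis
    by (simp add: mult_ac)
qed

lemma orthonormal_basis_card_ne_one:
  fixes b :: "'i::finite \<Rightarrow> ('p::prime_card, 'd::finite) fq_vec \<Rightarrow> complex"
  assumes "orthonormal_basis I b"
  shows "card I \<noteq> 1"
proof
  assume "card I = 1"
  then obtain i where I: "I = {i}"
    by (auto simp: card_1_singleton_iff)
  have span: "\<exists>k. \<forall>x. f x = k * b i x" for f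
  proof -
    obtain c where "\<forall>x. f x = (\<Sum>j\<in>I. c j * b j x)"
      using assms unfolding orthonormal_basis_def by meson
    then show ?thesis
      by (auto simp: I)
  qed
  obtain k where k: "\<And>x. 1 = k * b i x"
    using span[of "\<lambda>_. 1"] by auto
  obtain l where l: "\<And>x. (if x = 0 then 1 else 0) = l * b i x"
    using span[of "\<lambda>x. if x = 0 then 1 else 0"] by auto
  have "vec 1 \<noteq> (0 :: ('p, 'd) fq_vec)"
    by (simp add: vec_eq_iff)
  then have "l * b i (vec 1) = 0"
    using l[of "vec 1"] by simp
  then have "l = 0"
    using k[of "vec 1"] by auto
  then show False
    using l[of 0] by simp
qed

theorem corollary2p4:
  assumes "odd CARD('p::prime_card)"
  shows "\<not> (\<exists>(A :: (('p, 'd::finite) fq_vec \<Rightarrow> ('p, 'd) fq_vec) set)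
              (\<Lambda> :: ('p, 'd) fq_vec set)
              (E :: ('p, 'd) fq_vec set)
              (\<psi> :: ('p, 'd) fq_vec \<Rightarrow> complex).
            A \<subseteq> Aut \<and> E \<subset> UNIV \<and> fourier \<psi> = indicator E \<and>
            orthonormal_basis (A \<times> \<Lambda>) (\<lambda>(a, t). dilation a (translation t \<psi>)))"
proof (intro notI, elim exE conjE)
  fix A :: "(('p, 'd) fq_vec \<Rightarrow> ('p, 'd) fq_vec) set" and \<Lambda> E :: "('p, 'd) fq_vec set"
    and \<psi> :: "('p, 'd) fq_vec \<Rightarrow> complex"
  assume A: "A \<subseteq> Aut" and hat: "fourier \<psi> = indicator E"
    and basis: "orthonormal_basis (A \<times> \<Lambda>) (\<lambda>(a, t). dilation a (translation t \<psi>))"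
  define \<mu> :: complex where "\<mu> = indicator E (0 :: ('p, 'd) fq_vec)"
  have "L2_inner \<psi> (\<lambda>_. 1) = \<mu>"
    unfolding \<mu>_def fourier_zero_eq_mean[symmetric] hat ..
  then have "L2_inner (case i of (a, t) \<Rightarrow> dilation a (translation t \<psi>)) (\<lambda>_. 1) = \<mu>"
    if "i \<in> A \<times> \<Lambda>" for i
    using that A by (auto simp: Aut_def mean_dilation_translation)
  with basis have "of_nat (card (A \<times> \<Lambda>)) * (\<mu> * cnj \<mu>) = 1"
    by (rule card_orthonormal_basis_of_equal_means)
  moreover have "\<mu> * cnj \<mu> = 0 \<or> \<mu> * cnj \<mu> = 1"
    by (auto simp: \<mu>_def indicator_def)
  ultimately have "card (A \<times> \<Lambda>) = 1"
    by (metis mult.right_neutral mult_zero_right of_nat_eq_1_iff zero_neq_one)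
  with orthonormal_basis_card_ne_one[OF basis] show False
    by contradiction
qed

end
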